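(* If $n_1\geq n_2\geq n_3$ are integers with $n_3\in \{2,3\}$, then $\mu_{\rm t}(K_{n_1}\,\square\, K_{n_2}\,\square\, K_{n_3}) = n_1+n_2-2$.
   Context: For a connected graph $G$ and $X\subseteq V(G)$, two vertices $x,y$ are $X$-visible if there is a shortest $x,y$-path none of whose internal vertices lies in $X$. $X$ is a total mutual-visibility set if every two vertices of $V(G)$ are $X$-visible. $\mu_{\rm t}(G)$ is the maximum cardinality of a total mutual-visibility set of $G$. $\square$ denotes the Cartesian product of graphs and $K_n$ the complete graph on $n$ vertices. *)

theory Defs
  imports "Graph_Theory.Graph_Theory"
begin

definition cartesian_product ::
    "'a pair_pre_digraph \<Rightarrow> 'b pair_pre_digraph \<Rightarrow> ('a \<times> 'b) pair_pre_digraph"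
    (infixl \<open>\<box>\<close> 70) where
  "G \<box> H = \<lparr> pverts = pverts G \<times> pverts H,
     parcs = {((g, h), (g', h')).
       (g = g' \<and> g \<in> pverts G \<and> (h, h') \<in> parcs H) \<or>
       ((g, g') \<in> parcs G \<and> h = h' \<and> h \<in> pverts H)} \<rparr>"

lemma pair_graph_cartesian_product:
  assumes "pair_graph G" "pair_graph H"
  shows "pair_graph (G \<box> H)"
proof -
  interpret G: pair_graph G by fact
  interpret H: pair_graph H by fact
  have wf: "parcs (G \<box> H) \<subseteq> pverts (G \<box> H) \<times> pverts (G \<box> H)"
    by (auto simp: cartesian_product_def dest: G.in_arcsD1 G.in_arcsD2 H.in_arcsD1 H.in_arcsD2)
  have fin: "finite (pverts (G \<box> H))"
    by (simp add: cartesian_product_def)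
  show ?thesis
  proof
    show "finite (parcs (G \<box> H))"
      using wf fin finite_subset by blast
    show "symmetric (with_proj (G \<box> H))"
      using G.sym_arcs H.sym_arcs
      by (auto simp: symmetric_def sym_def cartesian_product_def)
  qed (use wf fin G.no_loops' H.no_loops' in \<open>force simp: cartesian_product_def\<close>)+
qed

context pre_digraph
begin

definition shortest_apath :: "'a \<Rightarrow> 'b awalk \<Rightarrow> 'a \<Rightarrow> bool" where
  "shortest_apath x p y \<longleftrightarrow> apath x p y \<and> (\<forall>q. apath x q y \<longrightarrow> length p \<le> length q)"

definition visible :: "'a set \<Rightarrow> 'a \<Rightarrow> 'a \<Rightarrow> bool" where
  "visible X x y \<longleftrightarrow> (\<exists>p. shortest_apath x p y \<and> set (inner_verts p) \<inter> X = {})"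

text \<open>The case \<open>x = y\<close> is harmless: the empty walk is then the shortest path.\<close>
definition total_mutual_visibility_set :: "'a set \<Rightarrow> bool" where
  "total_mutual_visibility_set X \<longleftrightarrow>
     X \<subseteq> verts G \<and> (\<forall>x \<in> verts G. \<forall>y \<in> verts G. visible X x y)"

text \<open>
  Intended for finite connected graphs: there the empty set is a total mutual-visibility set,
  so the maximum ranges over a finite non-empty set.
\<close>
definition total_mutual_visibility_number :: nat (\<open>\<mu>\<^sub>t\<close>) where
  "total_mutual_visibility_number = Max (card ` {X. total_mutual_visibility_set X})"

end

end

theory Submission
  imports Defs
begin

text \<open>
  A set \<open>X\<close> of vertices of a product of three complete graphs is a total mutual-visibility set iff no
  two of its elements are at distance 2. Indeed, the two common neighbours of a pair at distance 2
  are themselves at distance 2, and conversely, if no two elements of \<open>X\<close> are at distance 2, then at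
  most one of the neighbours of \<open>u\<close> that are closer to \<open>v\<close> lies in \<open>X\<close>, so that geodesics avoiding
  \<open>X\<close> can be built greedily.

  To bound the size of such an \<open>X\<close>, consider its layers over the third coordinate. Each layer lies on a
  line of the grid, and two nonempty layers are either equal singletons or have disjoint projections
  to both axes. A nonempty layer has one element less than the total size of its two projections.
\<close>

section \<open>Visibility and Hamming distance\<close>

text \<open>This is the distance of the product graph: \<open>hamming_le_length\<close> bounds it by
  the length of any walk, and \<open>apath_avoiding\<close> provides a path of that length.\<close>

fun hamming :: "('a \<times> 'b) \<times> 'c \<Rightarrow> ('a \<times> 'b) \<times> 'c \<Rightarrow> nat" where
  "hamming ((a, b), c) ((a', b'), c') = of_bool (a \<noteq> a') + of_bool (b \<noteq> b') + of_bool (c \<noteq> c')"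

lemma hamming_self [simp]: "hamming u u = 0"
  by (cases "(u, u)" rule: hamming.cases) auto

lemma hamming_eq_0D: "hamming u v = 0 \<Longrightarrow> u = v"
  by (cases "(u, v)" rule: hamming.cases) (auto split: if_splits)

lemma hamming_triangle: "hamming u w \<le> hamming u v + hamming v w"
  by (cases "(u, v)" rule: hamming.cases; cases "(v, w)" rule: hamming.cases) auto

text \<open>There are at least two closer neighbours, any two of which are at distance 2, so one avoids \<open>X\<close>.\<close>
lemma closer_neighbour_avoiding:
  assumes X: "\<forall>x\<in>X. \<forall>y\<in>X. hamming x y \<noteq> 2"
    and "u \<in> (A \<times> B) \<times> C" "v \<in> (A \<times> B) \<times> C" and d: "hamming u v = Suc k" "k \<noteq> 0"
  obtains w where "w \<in> (A \<times> B) \<times> C" "w \<notin> X" "hamming u w = 1" "hamming w v = k"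
proof -
  obtain a b c a' b' c' where uv: "u = ((a, b), c)" "v = ((a', b'), c')"
    by (metis prod.collapse)
  note wI = that
  have *: thesis
    if "w \<in> (A \<times> B) \<times> C" "w' \<in> (A \<times> B) \<times> C" "hamming u w = 1" "hamming w v = k"
      "hamming u w' = 1" "hamming w' v = k" "hamming w w' = 2" for w w'
    using that X wI by (cases "w \<in> X") blast+
  show thesis
  \<comment> \<open>Each candidate moves one coordinate of \<open>u\<close> to its value in
    \<open>v\<close>. The case split only picks two coordinates in which \<open>u\<close> and
    \<open>v\<close> differ; they exist since \<open>k \<noteq> 0\<close>.\<close>
  proof (cases "a = a'")
    case True
    show thesis
      by (rule *[of "((a, b'), c)" "((a, b), c')"])
        (use assms uv True in \<open>auto simp: of_bool_def split: if_splits\<close>)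
  next
    case False
    show thesis
    proof (cases "b = b'")
      case True
      show thesis
        by (rule *[of "((a', b), c)" "((a, b), c')"])
          (use assms uv True False in \<open>auto simp: of_bool_def split: if_splits\<close>)
    next
      case b: False
      show thesis
        by (rule *[of "((a', b), c)" "((a, b'), c)"])
          (use assms uv b False in \<open>auto simp: of_bool_def split: if_splits\<close>)
    qed
  qed
qed

text \<open>Hides the complete factors behind their vertex sets. The pairs are nested to the left
  because \<open>\<box>\<close> associates to the left.\<close>

locale complete_product = pair_wf_digraph H for H :: "(('a \<times> 'b) \<times> 'c) pair_pre_digraph" +
  fixes A :: "'a set" and B :: "'b set" and C :: "'c set"
  assumes pverts_eq: "pverts H = (A \<times> B) \<times> C"
    and parcs_eq: "parcs H = {(u, v). u \<in> pverts H \<and> v \<in> pverts H \<and> hamming u v = 1}"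
begin

section \<open>Geodesics and total mutual-visibility in the product\<close>

lemma hamming_le_length: "awalk u p v \<Longrightarrow> hamming u v \<le> length p"
proof (induction p arbitrary: u)
  case (Cons e p)
  then have "hamming u (snd e) = 1" "awalk (snd e) p v"
    by (auto simp: awalk_Cons_iff parcs_eq)
  with Cons.IH hamming_triangle[of u v "snd e"] show ?case
    by fastforce
qed (simp add: awalk_Nil_iff)

text \<open>Greedy construction by induction on the distance to \<open>v\<close>. The last conjunct
  strengthens the induction: it shows that \<open>u\<close>, being farther from \<open>v\<close>
  than everything on the rest of the walk, is not repeated.\<close>

lemma apath_avoiding:
  assumes X: "\<forall>x\<in>X. \<forall>y\<in>X. hamming x y \<noteq> 2" and v: "v \<in> pverts H"
  shows "u \<in> pverts H \<Longrightarrow> \<exists>p. apath u p v \<and> length p = hamming u v \<and>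
    set (awalk_verts u p) \<inter> X \<subseteq> {u, v} \<and> (\<forall>x\<in>set (awalk_verts u p). hamming x v \<le> hamming u v)"
proof (induction "hamming u v" arbitrary: u)
  case 0
  then show ?case
    using v by (intro exI[of _ "[]"]) (auto simp: apath_Nil_iff dest: hamming_eq_0D)
next
  case (Suc k)
  \<comment> \<open>The endpoint \<open>v\<close> may lie in \<open>X\<close>, hence the exception
    for the final step, where \<open>k = 0\<close>.\<close>
  obtain w where w: "w \<in> pverts H" "w \<notin> X \<or> w = v" "hamming u w = 1" "hamming w v = k"
  proof (cases "k = 0")
    case True
    then show thesis using that[of v] v Suc by simp
  next
    case False
    then show thesis
      using closer_neighbour_avoiding[OF X, of u A B C v k] Suc v that
      unfolding pverts_eq by metis
  qed
  obtain p where p: "apath w p v" "length p = hamming w v"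
    "set (awalk_verts w p) \<inter> X \<subseteq> {w, v}" "\<forall>x\<in>set (awalk_verts w p). hamming x v \<le> hamming w v"
    using Suc.hyps(1)[of w] w by auto
  have "u \<notin> set (awalk_verts w p)"
    using p(4) w(4) Suc.hyps(2) by fastforce
  then have "apath u ((u, w) # p) v"
    using p(1) w Suc.prems by (simp add: apath_Cons_iff parcs_eq)
  moreover have "set (awalk_verts u ((u, w) # p)) \<inter> X \<subseteq> {u, v}"
    using p(3) w(2) by auto
  moreover have "\<forall>x\<in>set (awalk_verts u ((u, w) # p)). hamming x v \<le> hamming u v"
    using p(4) w(4) Suc.hyps(2) by fastforce
  ultimately show ?case
    using p(2) w(4) Suc.hyps(2) by (intro exI[of _ "(u, w) # p"]) auto
qed

lemma visible_if_no_distance_2: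
  assumes "\<forall>x\<in>X. \<forall>y\<in>X. hamming x y \<noteq> 2" "u \<in> pverts H" "v \<in> pverts H"
  shows "visible X u v"
proof -
  obtain p where p: "apath u p v" "length p = hamming u v" "set (awalk_verts u p) \<inter> X \<subseteq> {u, v}"
    using apath_avoiding[OF assms(1,3,2)] by auto
  then have "shortest_apath u p v"
    using hamming_le_length unfolding shortest_apath_def by (auto simp: apath_def)
  moreover have "set (inner_verts p) \<inter> X = {}"
    using p(3) set_inner_verts[OF p(1)] by auto
  ultimately show ?thesis
    unfolding visible_def by blast
qed

lemma no_distance_2_if_visible:
  assumes X: "\<forall>u\<in>pverts H. \<forall>v\<in>pverts H. visible X u v" "X \<subseteq> pverts H"
    and x: "x \<in> X" "y \<in> X"
  shows "hamming x y \<noteq> 2"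
proof
  assume d: "hamming x y = 2"
  obtain a b c a' b' c' where xy: "x = ((a, b), c)" "y = ((a', b'), c')"
    by (metis prod.collapse)
  have V: "a \<in> A" "a' \<in> A" "b \<in> B" "b' \<in> B" "c \<in> C" "c' \<in> C"
    using X(2) x xy by (auto simp: pverts_eq)
  \<comment> \<open>\<open>x\<close> and \<open>y\<close> are opposite corners of a 4-cycle;
    \<open>u\<close> and \<open>v\<close> are its other two corners.\<close>
  obtain u v where uv: "u \<in> pverts H" "v \<in> pverts H" "hamming u v = 2" "hamming u x = 1" "hamming x v = 1"
    and only: "\<And>w. hamming u w = 1 \<Longrightarrow> hamming w v = 1 \<Longrightarrow> w = x \<or> w = y"
  proof -
    consider "a = a'" "b \<noteq> b'" "c \<noteq> c'" | "a \<noteq> a'" "b = b'" "c \<noteq> c'" | "a \<noteq> a'" "b \<noteq> b'" "c = c'"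
      using d xy by (cases "a = a'"; cases "b = b'"; cases "c = c'") auto
    then show thesis
    proof cases
      case 1
      show thesis
        by (rule that[of "((a, b'), c)" "((a, b), c')"]) (use 1 V xy in \<open>auto simp: pverts_eq split: if_splits\<close>)
    next
      case 2
      show thesis
        by (rule that[of "((a', b), c)" "((a, b), c')"]) (use 2 V xy in \<open>auto simp: pverts_eq split: if_splits\<close>)
    next
      case 3
      show thesis
        by (rule that[of "((a', b), c)" "((a, b'), c)"]) (use 3 V xy in \<open>auto simp: pverts_eq split: if_splits\<close>)
    qed
  qed
  obtain p where p: "shortest_apath u p v" "set (inner_verts p) \<inter> X = {}"
    using X(1) uv unfolding visible_def by blast
  have "u \<noteq> x" "x \<noteq> v" "u \<noteq> v" using uv by auto
  then have "apath u [(u, x), (x, v)] v"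
    using uv X(2) x by (auto simp: apath_simps parcs_eq)
  then have "length p \<le> 2"
    using p(1) unfolding shortest_apath_def by fastforce
  moreover have "hamming u v \<le> length p"
    using p(1) hamming_le_length by (auto simp: shortest_apath_def apath_def)
  ultimately have "length p = 2"
    using uv(3) by simp
  \<comment> \<open>The only inner vertex of \<open>p\<close> is \<open>fst f\<close>, a common
    neighbour of \<open>u\<close> and \<open>v\<close>, hence \<open>x\<close> or
    \<open>y\<close>.\<close>
  then obtain e f where ef: "p = [e, f]"
    by (auto simp: numeral_2_eq_2 length_Suc_conv)
  then have "hamming u (fst f) = 1" "hamming (fst f) v = 1"
    using p(1) by (auto simp: shortest_apath_def apath_simps parcs_eq)
  with only have "fst f \<in> X" using x by blast
  with p(2) ef show False
    by (simp add: inner_verts_def)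
qed

theorem total_mutual_visibility_set_iff:
  "total_mutual_visibility_set X \<longleftrightarrow> X \<subseteq> (A \<times> B) \<times> C \<and> (\<forall>x\<in>X. \<forall>y\<in>X. hamming x y \<noteq> 2)"
  using visible_if_no_distance_2 no_distance_2_if_visible
  unfolding total_mutual_visibility_set_def by (auto simp flip: pverts_eq)

end

lemma complete_product_cartesian_product:
  assumes "complete_digraph n1 (with_proj G1)" "complete_digraph n2 (with_proj G2)"
    "complete_digraph n3 (with_proj G3)"
  shows "complete_product (G1 \<box> G2 \<box> G3) (pverts G1) (pverts G2) (pverts G3)"
proof -
  have "pair_graph (G1 \<box> G2 \<box> G3)"
    using assms by (intro pair_graph_cartesian_product pair_graphI_complete)
  then interpret pair_graph "G1 \<box> G2 \<box> G3" .
  show ?thesis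
  proof
    show "pverts (G1 \<box> G2 \<box> G3) = (pverts G1 \<times> pverts G2) \<times> pverts G3"
      by (simp add: cartesian_product_def)
    show "parcs (G1 \<box> G2 \<box> G3) = {(u, v). u \<in> pverts (G1 \<box> G2 \<box> G3) \<and>
        v \<in> pverts (G1 \<box> G2 \<box> G3) \<and> hamming u v = 1}"
      using assms by (auto simp: cartesian_product_def complete_digraph_pair_def split: if_splits)
  qed
qed

section \<open>Sets without two points at distance 2\<close>

text \<open>The distance condition inside one layer: with equal third coordinates, the other two
  must not both differ.\<close>

definition collinear_grid :: "('a \<times> 'b) set \<Rightarrow> bool" where
  "collinear_grid S \<longleftrightarrow> (\<forall>p\<in>S. \<forall>q\<in>S. fst p = fst q \<or> snd p = snd q)"

text \<open>The distance condition between two different layers: the third coordinate already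
  contributes 1, so the other two must not contribute exactly 1.\<close>

definition compatible :: "('a \<times> 'b) set \<Rightarrow> ('a \<times> 'b) set \<Rightarrow> bool" where
  "compatible S T \<longleftrightarrow> (\<forall>p\<in>S. \<forall>q\<in>T. fst p = fst q \<longleftrightarrow> snd p = snd q)"

lemma compatible_sym: "compatible S T \<Longrightarrow> compatible T S"
  unfolding compatible_def by metis

lemma collinear_grid_cases:
  assumes "collinear_grid S" "S \<noteq> {}"
  obtains a where "S = {a} \<times> snd ` S" | b where "S = fst ` S \<times> {b}"
proof -
  obtain a b where p: "(a, b) \<in> S" using assms(2) by auto
  show thesis
  proof (cases "\<forall>q\<in>S. fst q = a")
    case True
    then have "S = {a} \<times> snd ` S" by force
    then show thesis by (rule that(1))
  next
    case False
    then obtain c where c: "c \<in> S" "fst c \<noteq> a"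
      by blast
    moreover from this have "snd c = b"
      using assms(1) p unfolding collinear_grid_def by (metis fst_conv snd_conv)
    \<comment> \<open>Otherwise \<open>q\<close> would share its first coordinate with both
      \<open>(a, b)\<close> and \<open>c\<close>, which differ there.\<close>
    ultimately have "snd q = b" if "q \<in> S" for q
      using assms(1) p that unfolding collinear_grid_def by (metis fst_conv snd_conv)
    then have "S = fst ` S \<times> {b}" by force
    then show thesis by (rule that(2))
  qed
qed

text \<open>On a line one projection is a single point and the other is injective. The equation is
  meant for adding up disjoint projections, the inequality for estimating a single layer.\<close>

lemma card_collinear_grid:
  assumes "collinear_grid S" "S \<noteq> {}" "finite S"
  shows "card S + 1 = card (fst ` S) + card (snd ` S)"
    and "card S \<le> max (card (fst ` S)) (card (snd ` S))"
proof -
  have *: "card S = card (snd ` S) \<and> card (fst ` S) = 1 \<or> card S = card (fst ` S) \<and> card (snd ` S) = 1"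
    using assms(1,2)
  proof (cases rule: collinear_grid_cases)
    case (1 a)
    then have "card S = card (snd ` S)" "fst ` S = {a}"
      using assms(2) by (metis card_cartesian_product_singleton, force)
    then show ?thesis by simp
  next
    case (2 b)
    then have "card S = card (fst ` S) * card {b}" "snd ` S = {b}"
      using assms(2) by (metis card_cartesian_product, force)
    then show ?thesis by simp
  qed
  then show "card S + 1 = card (fst ` S) + card (snd ` S)" by auto
  show "card S \<le> max (card (fst ` S)) (card (snd ` S))" using * by auto
qed

text \<open>Points of \<open>S\<close> and \<open>T\<close> that agree in one coordinate coincide.
  Given a common point \<open>p\<close>, any other point of \<open>S\<close> or \<open>T\<close> is
  collinear with \<open>p\<close>, which belongs to the opposite set, and so equals
  \<open>p\<close>.\<close>

lemma compatible_cases: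
  assumes "compatible S T" "collinear_grid S" "collinear_grid T"
  shows "(\<exists>p. S = {p} \<and> T = {p}) \<or> fst ` S \<inter> fst ` T = {} \<and> snd ` S \<inter> snd ` T = {}"
proof (cases "S \<inter> T = {}")
  case True
  have "p \<in> T" if "p \<in> S" "q \<in> T" "fst p = fst q \<or> snd p = snd q" for p q
    using assms(1) that unfolding compatible_def by (metis prod_eqI)
  with True show ?thesis by blast
next
  case False
  then obtain p where p: "p \<in> S" "p \<in> T" by auto
  have "q = p" if "q \<in> S" for q
    using assms(1,2) p that unfolding compatible_def collinear_grid_def by (metis prod_eqI)
  moreover have "q = p" if "q \<in> T" for q
    using assms(1,3) p that unfolding compatible_def collinear_grid_def by (metis prod_eqI)
  ultimately show ?thesis using p by blast
qed

section \<open>Upper bound for two and three layers\<close>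

context
  fixes A :: "'a set" and B :: "'b set"
  assumes fin: "finite A" "finite B" and AB: "card B \<le> card A" "2 \<le> card B"
begin

lemma card_collinear_grid_le:
  assumes "S \<subseteq> A \<times> B" "collinear_grid S"
  shows "card S \<le> card A"
proof (cases "S = {}")
  case False
  have "finite S" using assms(1) fin by (metis finite_SigmaI finite_subset)
  moreover have "card (fst ` S) \<le> card A" "card (snd ` S) \<le> card B"
    using assms(1) fin by (auto intro!: card_mono)
  ultimately show ?thesis
    using card_collinear_grid(2)[OF assms(2) False] AB by linarith
qed simp

lemma card_two_compatible:
  assumes S: "S \<subseteq> A \<times> B" "collinear_grid S" and T: "T \<subseteq> A \<times> B" "collinear_grid T"
    and ST: "compatible S T"
  shows "card S + card T + 2 \<le> card A + card B"
proof (cases "S = {} \<or> T = {}")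
  case True
  then show ?thesis
    using card_collinear_grid_le[OF S] card_collinear_grid_le[OF T] AB by auto
next
  case False
  have f: "finite S" "finite T" using S T fin by (metis finite_SigmaI finite_subset)+
  consider p where "S = {p}" "T = {p}" | "fst ` S \<inter> fst ` T = {}" "snd ` S \<inter> snd ` T = {}"
    using compatible_cases[OF ST S(2) T(2)] by blast
  then show ?thesis
  proof cases
    case (1 p)
    then show ?thesis using AB by simp
  next
    case 2
    \<comment> \<open>Disjoint projections use at most \<open>card A + card B\<close> values in
      total, and each of the two layers has one element less than its share.\<close>
    have "card (fst ` S \<union> fst ` T) \<le> card A" "card (snd ` S \<union> snd ` T) \<le> card B"
      using S T fin by (auto intro!: card_mono)
    then have "card (fst ` S) + card (fst ` T) \<le> card A" "card (snd ` S) + card (snd ` T) \<le> card B"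
      using 2 f by (simp_all add: card_Un_disjoint)
    then show ?thesis
      using card_collinear_grid(1)[OF S(2)] card_collinear_grid(1)[OF T(2)] f False by simp
  qed
qed

text \<open>Treats a singleton \<open>{p}\<close> occurring as two layers: the 4 consists of these
  two elements and the 2 of the final bound. A third layer other than \<open>{p}\<close> avoids the
  row and the column of \<open>p\<close>, so it has at most \<open>card A - 1\<close>
  elements.\<close>

lemma card_compatible_doubleton_layers:
  assumes B: "3 \<le> card B" and p: "p \<in> A \<times> B"
    and S: "S \<subseteq> A \<times> B" "collinear_grid S" "compatible {p} S"
  shows "card S + 4 \<le> card A + card B"
proof (cases "S = {}")
  case False
  have "finite S" using S fin by (metis finite_SigmaI finite_subset)
  have "collinear_grid {p}" by (simp add: collinear_grid_def)
  then consider "S = {p}" | "fst ` {p} \<inter> fst ` S = {}" "snd ` {p} \<inter> snd ` S = {}"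
    using compatible_cases[OF S(3) _ S(2)] by auto
  then show ?thesis
  proof cases
    case 1
    then show ?thesis using AB B by simp
  next
    case 2
    moreover have "fst ` S \<subseteq> A" "snd ` S \<subseteq> B"
      using S(1) by auto
    ultimately have "fst ` S \<subseteq> A - {fst p}" "snd ` S \<subseteq> B - {snd p}"
      by blast+
    then have "card (fst ` S) \<le> card (A - {fst p})" "card (snd ` S) \<le> card (B - {snd p})"
      using fin by (auto intro!: card_mono)
    moreover have "card (A - {fst p}) = card A - 1" "card (B - {snd p}) = card B - 1"
      using p by auto
    ultimately show ?thesis
      using card_collinear_grid(2)[OF S(2) False \<open>finite S\<close>] AB B by linarith
  qed
qed (use AB B in simp)

text \<open>An empty layer leaves two layers, and a repeated singleton falls under the previous
  lemma. Otherwise all projections are disjoint and the three layers save 3, one more than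
  required.\<close>

lemma card_three_compatible:
  assumes B: "3 \<le> card B"
    and S: "S \<subseteq> A \<times> B" "collinear_grid S" and T: "T \<subseteq> A \<times> B" "collinear_grid T"
    and U: "U \<subseteq> A \<times> B" "collinear_grid U"
    and compat: "compatible S T" "compatible S U" "compatible T U"
  shows "card S + card T + card U + 2 \<le> card A + card B"
proof -
  have f: "finite S" "finite T" "finite U" using S T U fin by (metis finite_SigmaI finite_subset)+
  note cases = compatible_cases[OF compat(1) S(2) T(2)] compatible_cases[OF compat(2) S(2) U(2)]
    compatible_cases[OF compat(3) T(2) U(2)]
  consider "S = {}" | "T = {}" | "U = {}"
    | p where "S = {p}" "T = {p}" | p where "S = {p}" "U = {p}" | p where "T = {p}" "U = {p}"
    | (disjoint) "S \<noteq> {}" "T \<noteq> {}" "U \<noteq> {}"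
      "\<nexists>p. S = {p} \<and> T = {p}" "\<nexists>p. S = {p} \<and> U = {p}" "\<nexists>p. T = {p} \<and> U = {p}"
    by metis
  then show ?thesis
  proof cases
    case 1
    then show ?thesis using card_two_compatible[OF T U compat(3)] by simp
  next
    case 2
    then show ?thesis using card_two_compatible[OF S U compat(2)] by simp
  next
    case 3
    then show ?thesis using card_two_compatible[OF S T compat(1)] by simp
  next
    case (4 p)
    then show ?thesis
      using card_compatible_doubleton_layers[OF B _ U, of p] S(1) compat(2) by simp
  next
    case (5 p)
    then show ?thesis
      using card_compatible_doubleton_layers[OF B _ T, of p] S(1) compat(1) by simp
  next
    case (6 p)
    then show ?thesis
      using card_compatible_doubleton_layers[OF B _ S, of p] T(1) compatible_sym[OF compat(1)] by simp
  next
    case disjoint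
    have "fst ` S \<inter> fst ` T = {}" "fst ` S \<inter> fst ` U = {}" "fst ` T \<inter> fst ` U = {}"
      "snd ` S \<inter> snd ` T = {}" "snd ` S \<inter> snd ` U = {}" "snd ` T \<inter> snd ` U = {}"
      using cases disjoint(4-6) by (simp_all only: simp_thms)
    then have "card (fst ` S \<union> fst ` T \<union> fst ` U) = card (fst ` S) + card (fst ` T) + card (fst ` U)"
      "card (snd ` S \<union> snd ` T \<union> snd ` U) = card (snd ` S) + card (snd ` T) + card (snd ` U)"
      using f by (simp_all add: card_Un_disjoint Int_Un_distrib2)
    moreover have "card (fst ` S \<union> fst ` T \<union> fst ` U) \<le> card A"
      "card (snd ` S \<union> snd ` T \<union> snd ` U) \<le> card B"
      using S(1) T(1) U(1) fin by (auto intro!: card_mono)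
    ultimately show ?thesis
      using card_collinear_grid(1)[OF S(2) disjoint(1) f(1)]
        card_collinear_grid(1)[OF T(2) disjoint(2) f(2)]
        card_collinear_grid(1)[OF U(2) disjoint(3) f(3)] by linarith
  qed
qed

lemma card_no_distance_2_le:
  assumes C: "card C = 2 \<or> card C = 3 \<and> 3 \<le> card B"
    and X: "X \<subseteq> (A \<times> B) \<times> C" "\<forall>x\<in>X. \<forall>y\<in>X. hamming x y \<noteq> 2"
  shows "card X + 2 \<le> card A + card B"
proof -
  define L where "L c = {p. (p, c) \<in> X}" for c
  have d: "hamming (p, c) (q, d) \<noteq> 2" if "p \<in> L c" "q \<in> L d" for p c q d
    using X(2) that unfolding L_def by blast
  have L: "L c \<subseteq> A \<times> B" "collinear_grid (L c)" for c
  proof -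
    show "L c \<subseteq> A \<times> B"
      using X(1) by (auto simp: L_def)
    have "fst p = fst q \<or> snd p = snd q" if "p \<in> L c" "q \<in> L c" for p q
      using d[OF that] by (cases p; cases q) (auto simp: of_bool_def split: if_splits)
    then show "collinear_grid (L c)"
      unfolding collinear_grid_def by blast
  qed
  have compat: "compatible (L c) (L d)" if "c \<noteq> d" for c d
  proof -
    have "fst p = fst q \<longleftrightarrow> snd p = snd q" if "p \<in> L c" "q \<in> L d" for p q
      using d[OF that] \<open>c \<noteq> d\<close> by (cases p; cases q) (auto simp: of_bool_def split: if_splits)
    then show ?thesis
      unfolding compatible_def by blast
  qed
  have finC: "finite C"
    using C by (auto intro: card_ge_0_finite)
  have finL: "finite (L c)" for c
    using L(1) fin by (meson finite_SigmaI finite_subset)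
  \<comment> \<open>The converse moves the layer index to the second component, where
    \<open>X\<close> has it.\<close>
  have "X = (SIGMA c:C. L c)\<inverse>"
    using X(1) by (auto simp: L_def)
  then have "card X = card (SIGMA c:C. L c)"
    by simp
  also have "\<dots> = (\<Sum>c\<in>C. card (L c))"
    using finC finL by simp
  finally have cX: "card X = (\<Sum>c\<in>C. card (L c))" .
  from C show ?thesis
  proof
    assume "card C = 2"
    then obtain c d where "C = {c, d}" "c \<noteq> d" by (auto simp: card_2_iff)
    then show ?thesis
      using cX card_two_compatible[OF L L compat, of c d] by simp
  next
    assume C3: "card C = 3 \<and> 3 \<le> card B"
    then obtain c d e where "C = {c, d, e}" "c \<noteq> d" "c \<noteq> e" "d \<noteq> e" by (auto simp: card_3_iff)
    then show ?thesis
      using cX C3 card_three_compatible[OF _ L L L compat compat compat, of c d e] by simp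
  qed
qed

end

section \<open>A set attaining the bound\<close>

lemma ex_no_distance_2:
  assumes fin: "finite A" "finite B" and ne: "A \<noteq> {}" "B \<noteq> {}" and C: "c \<in> C" "d \<in> C" "c \<noteq> d"
  obtains X where "X \<subseteq> (A \<times> B) \<times> C" "\<forall>x\<in>X. \<forall>y\<in>X. hamming x y \<noteq> 2" "card X = card A + card B - 2"
proof -
  obtain a b where ab: "a \<in> A" "b \<in> B" using ne by auto
  \<comment> \<open>Two perpendicular lines in different layers, each without the point over
    \<open>(a, b)\<close>. Distinct points of the same line are at distance 1; points of different
    lines differ in all three coordinates.\<close>
  define P where "P = (\<lambda>a'. ((a', b), c)) ` (A - {a})"
  define Q where "Q = (\<lambda>b'. ((a, b'), d)) ` (B - {b})"
  have "card P = card A - 1" "card Q = card B - 1"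
    unfolding P_def Q_def using ab by (simp_all add: card_image inj_on_def)
  moreover have "card (P \<union> Q) = card P + card Q"
    using fin C(3) by (intro card_Un_disjoint) (auto simp: P_def Q_def)
  moreover have "card A > 0" "card B > 0"
    using fin ne by auto
  ultimately have "card (P \<union> Q) = card A + card B - 2"
    by linarith
  moreover have "P \<union> Q \<subseteq> (A \<times> B) \<times> C"
    using ab C by (auto simp: P_def Q_def)
  moreover have "\<forall>x\<in>P \<union> Q. \<forall>y\<in>P \<union> Q. hamming x y \<noteq> 2"
    using C(3) by (auto simp: P_def Q_def of_bool_def split: if_splits)
  ultimately show thesis using that by blast
qed

theorem theorem3p2:
  fixes n1 n2 n3 :: nat
    and G1 :: "'a pair_pre_digraph"
    and G2 :: "'b pair_pre_digraph"
    and G3 :: "'c pair_pre_digraph"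
  assumes "n1 \<ge> n2" and "n2 \<ge> n3" and "n3 \<in> {2, 3}"
    and "complete_digraph n1 (with_proj G1)"
    and "complete_digraph n2 (with_proj G2)"
    and "complete_digraph n3 (with_proj G3)"
  shows "pre_digraph.total_mutual_visibility_number (with_proj (G1 \<box> G2 \<box> G3)) = n1 + n2 - 2"
proof -
  let ?A = "pverts G1" and ?B = "pverts G2" and ?C = "pverts G3"
  interpret complete_product "G1 \<box> G2 \<box> G3" ?A ?B ?C
    by (rule complete_product_cartesian_product[OF assms(4-6)])
  have fin: "finite ?A" "finite ?B" "finite ?C" and card: "card ?A = n1" "card ?B = n2" "card ?C = n3"
    using assms(4-6) by (simp_all add: complete_digraph_pair_def)
  let ?T = "{X. total_mutual_visibility_set X}"
  have "?T \<subseteq> Pow ((?A \<times> ?B) \<times> ?C)"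
    by (auto simp: total_mutual_visibility_set_iff)
  then have "finite ?T"
    using fin by (meson finite_Pow_iff finite_SigmaI finite_subset)
  \<comment> \<open>For \<open>n3 = 3\<close> the condition \<open>3 \<le> card B\<close> comes from
    \<open>n2 \<ge> n3\<close>.\<close>
  have upper: "card X \<le> n1 + n2 - 2" if "X \<in> ?T" for X
    using card_no_distance_2_le[OF fin(1,2), of ?C X] that assms(1-3) card
    by (auto simp: total_mutual_visibility_set_iff)
  \<comment> \<open>The extremal set needs two different layers.\<close>
  have "\<not> card ?C \<le> Suc 0"
    using assms(3) card by auto
  then obtain c d where cd: "c \<in> ?C" "d \<in> ?C" "c \<noteq> d"
    using fin(3) card_le_Suc0_iff_eq by blast
  have ne: "?A \<noteq> {}" "?B \<noteq> {}"
    using assms(1-3) card by auto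
  obtain X where "X \<subseteq> (?A \<times> ?B) \<times> ?C" "\<forall>x\<in>X. \<forall>y\<in>X. hamming x y \<noteq> 2"
    "card X = n1 + n2 - 2"
    by (rule ex_no_distance_2[OF fin(1,2) ne cd, unfolded card])
  then have X: "X \<in> ?T" "card X = n1 + n2 - 2"
    by (simp_all add: total_mutual_visibility_set_iff)
  show ?thesis
    unfolding total_mutual_visibility_number_def
    by (intro Max_eqI finite_imageI) (use \<open>finite ?T\<close> upper X in \<open>blast | metis imageI\<close>)+
qed

end
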